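(* Let $A \in \mathbb{R}^{n\times d}$ have full row-rank, let $b \in \mathbb{R}^n$, and let $f(x) = \tfrac12\|Ax-b\|^2$ for $x\in\mathbb{R}^d$. For $\lambda>0$ define $\hat f_\lambda(x,p) = \tfrac12\|Ax-b+\lambda p\|^2$ for $(x,p)\in\mathbb{R}^d\times\mathbb{R}^n$. Consider gradient descent applied to $\hat f_\lambda$ with a sufficiently small fixed step-size and starting from the origin $(x_0,p_0)=(0,0)$, and let $(x_t,p_t)$ be its iterates. Then: (i) For every $\lambda>0$, the iterates $x_t$ converge to the unique solution of the ridge-regression problem, namely $$\lim_{t\to\infty} x_t = x^*(\lambda) := \arg\min_{x\in\mathbb{R}^d}\bigl\{\|Ax-b\|^2+\lambda^2\|x\|^2\bigr\} = (A^{\top}A+\lambda^2 I)^{-1}A^{\top}b.$$ (ii) Furthermore, $x^*(\lambda)$ satisfies $$\lim_{\lambda\to 0^+} x^*(\lambda) = A^{\dagger}b,\qquad \lim_{\lambda\to\infty} x^*(\lambda)=0,\qquad \lim_{\lambda\to 0^+} f\bigl(x^*(\lambda)\bigr)=0,\qquad \lim_{\lambda\to\infty} f\bigl(x^*(\lambda)\bigr)=\tfrac12\|b\|^2 .$$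
   Context: $\|\cdot\|$ is the Euclidean norm, $A^{\dagger}$ is the Moore–Penrose inverse of $A$, and $I$ is the identity matrix of the appropriate size. Gradient descent on $\hat f_\lambda$ with fixed step-size $\alpha>0$ is the iteration $(x_{t+1},p_{t+1}) = (x_t,p_t)-\alpha\nabla\hat f_\lambda(x_t,p_t)$, where the gradient is taken jointly in $(x,p)$. "Sufficiently small fixed step-size" means that there is $\alpha_0>0$ (which may depend on $A$ and $\lambda$) such that the conclusion holds for every $\alpha\in(0,\alpha_0)$. *)

theory Defs
  imports "HOL-Analysis.Analysis"
begin

definition gradient :: "('a::real_inner \<Rightarrow> real) \<Rightarrow> 'a \<Rightarrow> 'a" where
  "gradient f x = (THE D. GDERIV f x :> D)"

text \<open>The gradient is unique, so the description above is meaningful whenever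
  \<open>f\<close> is differentiable with a gradient at \<open>x\<close>.\<close>

lemma gradient_eqI:
  assumes "GDERIV f x :> D"
  shows "gradient f x = D"
  unfolding gradient_def
proof (rule the_equality)
  fix E assume "GDERIV f x :> E"
  with assms have "(\<lambda>h. inner h E) = (\<lambda>h. inner h D)"
    unfolding gderiv_def by (rule has_derivative_unique[rotated])
  then have "inner h (E - D) = 0" for h
    by (auto simp: fun_eq_iff inner_diff_right)
  from this[of "E - D"] show "E = D"
    by simp
qed (rule assms)

primrec gradient_descent ::
  "('a::real_inner \<Rightarrow> real) \<Rightarrow> real \<Rightarrow> 'a \<Rightarrow> nat \<Rightarrow> 'a" where
  "gradient_descent f \<alpha> z0 0 = z0"
| "gradient_descent f \<alpha> z0 (Suc t) =
     gradient_descent f \<alpha> z0 t - \<alpha> *\<^sub>R gradient f (gradient_descent f \<alpha> z0 t)"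

definition least_squares :: "real^'d^'n \<Rightarrow> real^'n \<Rightarrow> real^'d \<Rightarrow> real" where
  "least_squares A b x = 1 / 2 * (norm (A *v x - b))\<^sup>2"

text \<open>The augmented loss is a function on the product space, whose inner product is the
  sum of those of the components; its gradient is therefore the joint one in \<open>(x, p)\<close>.\<close>

definition augmented_loss ::
  "real^'d^'n \<Rightarrow> real^'n \<Rightarrow> real \<Rightarrow> (real^'d) \<times> (real^'n) \<Rightarrow> real" where
  "augmented_loss A b r = (\<lambda>(x, p). 1 / 2 * (norm (A *v x - b + r *\<^sub>R p))\<^sup>2)"

definition ridge_objective ::
  "real^'d^'n \<Rightarrow> real^'n \<Rightarrow> real \<Rightarrow> real^'d \<Rightarrow> real" where
  "ridge_objective A b r x = (norm (A *v x - b))\<^sup>2 + r\<^sup>2 * (norm x)\<^sup>2"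

definition ridge_solution :: "real^'d^'n \<Rightarrow> real^'n \<Rightarrow> real \<Rightarrow> real^'d" where
  "ridge_solution A b r = arg_min (ridge_objective A b r) (\<lambda>_. True)"

text \<open>The Moore--Penrose inverse, characterised by the four Penrose conditions.\<close>

definition is_pinv :: "real^'d^'n \<Rightarrow> real^'n^'d \<Rightarrow> bool" where
  "is_pinv A X \<longleftrightarrow>
     A ** X ** A = A \<and> X ** A ** X = X \<and>
     transpose (A ** X) = A ** X \<and> transpose (X ** A) = X ** A"

lemma is_pinv_unique:
  assumes "is_pinv A X" "is_pinv A Y"
  shows "X = Y"
proof -
  have X: "A ** X ** A = A" "X ** A ** X = X"
      "transpose (A ** X) = A ** X" "transpose (X ** A) = X ** A"
    and Y: "A ** Y ** A = A" "Y ** A ** Y = Y"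
      "transpose (A ** Y) = A ** Y" "transpose (Y ** A) = Y ** A"
    using assms by (auto simp: is_pinv_def)
  have "A ** X = (A ** Y) ** (A ** X)"
    by (simp add: matrix_mul_assoc Y(1))
  also have "\<dots> = transpose ((A ** X) ** (A ** Y))"
    by (subst matrix_transpose_mul) (simp only: X(3) Y(3))
  also have "(A ** X) ** (A ** Y) = A ** Y"
    by (simp add: matrix_mul_assoc X(1))
  finally have 1: "A ** X = A ** Y" using Y(3) by simp
  have "X ** A = (X ** A) ** (Y ** A)"
    using Y(1) by (simp flip: matrix_mul_assoc)
  also have "\<dots> = transpose ((Y ** A) ** (X ** A))"
    by (subst matrix_transpose_mul) (simp only: X(4) Y(4))
  also have "(Y ** A) ** (X ** A) = Y ** A"
    using X(1) by (simp flip: matrix_mul_assoc)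
  finally have 2: "X ** A = Y ** A" using Y(4) by simp
  have "X = X ** (A ** X)"
    using X(2) by (simp add: matrix_mul_assoc)
  also have "\<dots> = (X ** A) ** Y"
    by (simp only: 1 matrix_mul_assoc)
  also have "\<dots> = Y"
    by (simp only: 2 Y(2))
  finally show ?thesis .
qed

definition pinv :: "real^'d^'n \<Rightarrow> real^'n^'d" where
  "pinv A = (THE X. is_pinv A X)"

end

theory Submission
  imports Defs
begin

text \<open>
  Write \<open>r\<close> for the parameter \<open>\<lambda>\<close>.  The gradient of the augmented loss at \<open>(x, p)\<close> is
  \<open>(A\<^sup>T e, r e)\<close> with the residual \<open>e = A x - b + r p\<close>.  Started at the origin, gradient descent
  therefore never leaves the subspace of the points \<open>(A\<^sup>T s, r s)\<close>, and on this subspace the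
  residual is \<open>M s - b\<close> with \<open>M = A A\<^sup>T + r\<^sup>2 I\<close>.  In the coordinate \<open>s\<close> the iteration becomes
  \<open>s \<mapsto> s - \<alpha> (M s - b)\<close> (lemma \<open>gradient_descent_augmented_loss\<close>).  Since
  \<open>\<langle>v, M v\<rangle> \<ge> r\<^sup>2 \<parallel>v\<parallel>\<^sup>2\<close>, this is a contraction for small \<open>\<alpha>\<close> (lemma \<open>richardson_converges\<close>), with
  limit \<open>s = M\<^sup>-\<^sup>1 b\<close>.  So \<open>x\<close> converges to \<open>A\<^sup>T M\<^sup>-\<^sup>1 b\<close>, and multiplying by \<open>A\<^sup>T A + r\<^sup>2 I\<close> shows that
  this point solves the normal equation \<open>(A\<^sup>T A + r\<^sup>2 I) x = A\<^sup>T b\<close> of ridge regression.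

  The ridge objective is strictly convex and quadratic, so that its only minimiser is the
  solution of the normal equation.  Both limits in \<open>r\<close> follow from testing a linear equation
  \<open>(A\<^sup>T A + r\<^sup>2 I) v = w\<close> with \<open>v\<close>: for \<open>r \<rightarrow> \<infinity>\<close> with \<open>v = x\<^sup>*\<close>, which gives
  \<open>r\<^sup>2 \<parallel>x\<^sup>*\<parallel> \<le> \<parallel>A\<^sup>T b\<parallel>\<close>, and for \<open>r \<rightarrow> 0\<close> with the difference of \<open>x\<^sup>*\<close> and \<open>A\<^sup>\<dagger> b\<close>.  The second case
  uses that \<open>A\<^sup>\<dagger> b\<close> both solves \<open>A x = b\<close> and lies in the range of \<open>A\<^sup>T\<close>, because
  \<open>A\<^sup>\<dagger> = A\<^sup>T (A A\<^sup>T)\<^sup>-\<^sup>1\<close> for a matrix of full row rank.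
\<close>

section \<open>Regularised Gram matrices\<close>

definition regularised_gram :: "real^'d^'n \<Rightarrow> real \<Rightarrow> real^'d^'d" where
  "regularised_gram A r = transpose A ** A + r\<^sup>2 *\<^sub>R mat 1"

lemma transpose_mult_inner:
  fixes A :: "real^'d^'n"
  shows "(transpose A *v y) \<bullet> x = y \<bullet> (A *v x)"
  by (simp add: dot_lmul_matrix)

lemma regularised_gram_mult_vector:
  "regularised_gram A r *v x = transpose A *v (A *v x) + r\<^sup>2 *\<^sub>R x"
  by (simp add: regularised_gram_def matrix_vector_mult_add_rdistrib
      scaleR_matrix_vector_assoc[symmetric] matrix_vector_mul_assoc[symmetric]
      del: transpose_matrix_vector)

lemma inner_regularised_gram:
  "x \<bullet> (regularised_gram A r *v x) = (norm (A *v x))\<^sup>2 + r\<^sup>2 * (norm x)\<^sup>2"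
  by (simp add: regularised_gram_mult_vector inner_add_right inner_commute[of x "transpose A *v _"]
      transpose_mult_inner power2_norm_eq_inner del: transpose_matrix_vector)

text \<open>The quadratic form of a regularised Gram matrix is positive definite for \<open>r \<noteq> 0\<close>, hence its
  kernel is trivial.\<close>

lemma invertible_regularised_gram:
  assumes "r \<noteq> 0"
  shows "invertible (regularised_gram A r)"
proof -
  have "x = 0" if "regularised_gram A r *v x = 0" for x
  proof -
    have "(norm (A *v x))\<^sup>2 + r\<^sup>2 * (norm x)\<^sup>2 = 0"
      using inner_regularised_gram[of x A r] that by simp
    then show "x = 0"
      using assms by (simp add: add_nonneg_eq_0_iff)
  qed
  then show ?thesis
    by (simp add: invertible_left_inverse matrix_left_invertible_ker)
qed

lemma matrix_mult_matrix_inv_vector: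
  fixes M :: "real^'n^'n"
  assumes "invertible M"
  shows "M *v (matrix_inv M *v b) = b"
proof -
  have "M ** matrix_inv M = mat 1"
    using someI_ex[OF assms[unfolded invertible_def]] by (simp add: matrix_inv_def)
  then show ?thesis by (simp add: matrix_vector_mul_assoc)
qed

section \<open>Ridge regression\<close>

text \<open>At a solution of the normal equation the linear term of the expansion vanishes and only
  the positive definite quadratic term is left.\<close>

lemma ridge_objective_expansion:
  assumes "regularised_gram A r *v x = transpose A *v b"
  shows "ridge_objective A b r (x + h) =
         ridge_objective A b r x + ((norm (A *v h))\<^sup>2 + r\<^sup>2 * (norm h)\<^sup>2)"
proof -
  have "h \<bullet> (transpose A *v (A *v x)) + r\<^sup>2 * (h \<bullet> x) = h \<bullet> (transpose A *v b)"
    using assms[THEN arg_cong, of "\<lambda>v. h \<bullet> v"]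
    by (simp add: regularised_gram_mult_vector inner_add_right del: transpose_matrix_vector)
  then have "(A *v x) \<bullet> (A *v h) + r\<^sup>2 * (h \<bullet> x) = b \<bullet> (A *v h)"
    by (simp only: inner_commute[of h "transpose A *v _"] transpose_mult_inner)
  then show ?thesis
    by (simp add: ridge_objective_def power2_norm_eq_inner matrix_vector_right_distrib
        inner_simps inner_commute algebra_simps)
qed

lemma is_arg_min_ridge_objective_iff:
  assumes "r \<noteq> 0" "regularised_gram A r *v x = transpose A *v b"
  shows "is_arg_min (ridge_objective A b r) (\<lambda>_. True) y \<longleftrightarrow> y = x"
proof -
  have *: "ridge_objective A b r y = ridge_objective A b r x +
      ((norm (A *v (y - x)))\<^sup>2 + r\<^sup>2 * (norm (y - x))\<^sup>2)" for y
    using ridge_objective_expansion[OF assms(2), of "y - x"] by simp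
  have ge: "ridge_objective A b r x \<le> ridge_objective A b r y" for y
    by (subst *[of y]) simp
  have less: "ridge_objective A b r x < ridge_objective A b r y" if "y \<noteq> x" for y
    by (subst *[of y]) (use that assms(1) in \<open>simp add: add_nonneg_pos\<close>)
  show ?thesis
    using ge less by (auto simp: is_arg_min_linorder dest: leD)
qed

lemma ridge_solution_eqI:
  assumes "r \<noteq> 0" "regularised_gram A r *v x = transpose A *v b"
  shows "ridge_solution A b r = x"
  using is_arg_min_ridge_objective_iff[OF assms]
  by (simp add: ridge_solution_def arg_min_def)

lemma ridge_solution_eq_matrix_inv:
  assumes "r \<noteq> 0"
  shows "ridge_solution A b r = matrix_inv (regularised_gram A r) *v (transpose A *v b)"
  by (intro ridge_solution_eqI matrix_mult_matrix_inv_vector invertible_regularised_gram assms)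

lemma ridge_solution_normal_equation:
  assumes "r \<noteq> 0"
  shows "regularised_gram A r *v ridge_solution A b r = transpose A *v b"
  unfolding ridge_solution_eq_matrix_inv[OF assms]
  by (intro matrix_mult_matrix_inv_vector invertible_regularised_gram assms)

text \<open>This rests on \<open>(A\<^sup>T A + r\<^sup>2 I) A\<^sup>T = A\<^sup>T (A A\<^sup>T + r\<^sup>2 I)\<close>; it identifies the limit of gradient
  descent, which is found in the range of \<open>A\<^sup>T\<close>.\<close>

lemma ridge_solution_eq_dual:
  assumes "r \<noteq> 0" "regularised_gram (transpose A) r *v s = b"
  shows "ridge_solution A b r = transpose A *v s"
proof (rule ridge_solution_eqI[OF assms(1)])
  show "regularised_gram A r *v (transpose A *v s) = transpose A *v b"
    unfolding assms(2)[symmetric]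
    by (simp add: regularised_gram_mult_vector matrix_vector_right_distrib
        matrix_vector_mult_scaleR del: transpose_matrix_vector)
qed

section \<open>Gradient descent on the augmented loss\<close>

text \<open>The iteration below is the Richardson iteration for \<open>M s = b\<close>.  For \<open>v\<close> the distance vector
  to the solution, \<open>\<parallel>v - \<alpha> M v\<parallel>\<^sup>2 \<le> (1 - 2 \<alpha> m + \<alpha>\<^sup>2 K\<^sup>2) \<parallel>v\<parallel>\<^sup>2\<close>, where \<open>K\<close> bounds the operator norm
  of \<open>M\<close>; for \<open>\<alpha> < m / K\<^sup>2\<close> the factor is at most \<open>1 - \<alpha> m\<close>.\<close>

lemma richardson_converges:
  fixes M :: "real^'n^'n"
  assumes "m > 0" and coercive: "\<And>v. m * (norm v)\<^sup>2 \<le> v \<bullet> (M *v v)"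
  shows "\<exists>\<alpha>0>0. \<forall>b s s' \<alpha>. 0 < \<alpha> \<and> \<alpha> < \<alpha>0 \<and> M *v s' = b \<and>
           (\<forall>t. s (Suc t) = s t - \<alpha> *\<^sub>R (M *v s t - b)) \<longrightarrow> s \<longlonglongrightarrow> s'"
proof -
  obtain K where "K > 0" and K: "\<And>v. norm (M *v v) \<le> norm v * K"
    using bounded_linear.pos_bounded[OF matrix_vector_mul_bounded_linear[of M]] by blast
  define \<alpha>0 where "\<alpha>0 = m / K\<^sup>2"
  have "\<alpha>0 > 0" using \<open>K > 0\<close> \<open>m > 0\<close> by (simp add: \<alpha>0_def)
  have "s \<longlonglongrightarrow> s'"
    if \<alpha>: "0 < \<alpha>" "\<alpha> < \<alpha>0" and "M *v s' = b"
      and step: "\<And>t. s (Suc t) = s t - \<alpha> *\<^sub>R (M *v s t - b)" for b s s' \<alpha>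
  proof -
    define q where "q = 1 - \<alpha> * m"
    define d where "d t = s t - s'" for t
    have contraction: "(norm (d (Suc t)))\<^sup>2 \<le> q * (norm (d t))\<^sup>2" for t
    proof -
      have d_step: "d (Suc t) = d t - \<alpha> *\<^sub>R (M *v d t)"
        by (simp add: d_def step \<open>M *v s' = b\<close>[symmetric] matrix_vector_mult_diff_distrib)
      have "(norm (M *v d t))\<^sup>2 \<le> (norm (d t) * K)\<^sup>2"
        by (intro power_mono K) simp
      then have "\<alpha>\<^sup>2 * (norm (M *v d t))\<^sup>2 \<le> \<alpha>\<^sup>2 * (norm (d t) * K)\<^sup>2"
        by (rule mult_left_mono) simp
      also have "\<dots> = \<alpha> * (\<alpha> * K\<^sup>2) * (norm (d t))\<^sup>2"
        by (simp add: power2_eq_square)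
      also have "\<dots> \<le> \<alpha> * m * (norm (d t))\<^sup>2"
        using \<alpha> \<open>K > 0\<close> by (intro mult_right_mono mult_left_mono) (auto simp: \<alpha>0_def field_simps)
      finally have quad: "\<alpha>\<^sup>2 * (norm (M *v d t))\<^sup>2 \<le> \<alpha> * m * (norm (d t))\<^sup>2" .
      have lin: "\<alpha> * (m * (norm (d t))\<^sup>2) \<le> \<alpha> * (d t \<bullet> (M *v d t))"
        using \<alpha> by (intro mult_left_mono coercive) simp
      have "(norm (d (Suc t)))\<^sup>2 =
          (norm (d t))\<^sup>2 - 2 * (\<alpha> * (d t \<bullet> (M *v d t))) + \<alpha>\<^sup>2 * (norm (M *v d t))\<^sup>2"
        unfolding d_step power2_norm_eq_inner
        by (simp add: inner_simps inner_commute power2_eq_square algebra_simps)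
      also have "\<dots> \<le> q * (norm (d t))\<^sup>2"
        using quad lin by (simp add: q_def algebra_simps)
      finally show ?thesis .
    qed
    \<comment> \<open>Coercivity implies \<open>m \<le> K\<close> and hence \<open>q \<ge> 0\<close>; the maximum spares this comparison.\<close>
    define q' where "q' = max 0 q"
    have q': "0 \<le> q'" "q' < 1"
      using \<alpha> \<open>m > 0\<close> by (auto simp: q'_def q_def)
    have bound: "(norm (d t))\<^sup>2 \<le> q' ^ t * (norm (d 0))\<^sup>2" for t
    proof (induction t)
      case (Suc t)
      have "(norm (d (Suc t)))\<^sup>2 \<le> q' * (norm (d t))\<^sup>2"
        by (rule order_trans[OF contraction]) (simp add: q'_def mult_right_mono)
      also have "\<dots> \<le> q' * (q' ^ t * (norm (d 0))\<^sup>2)"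
        by (intro mult_left_mono Suc.IH q')
      finally show ?case by (simp add: mult.assoc)
    qed simp
    have "(\<lambda>t. q' ^ t * (norm (d 0))\<^sup>2) \<longlonglongrightarrow> 0"
      using q' by (intro tendsto_mult_left_zero LIMSEQ_realpow_zero)
    then have "(\<lambda>t. (norm (d t))\<^sup>2) \<longlonglongrightarrow> 0"
      by (rule tendsto_sandwich[OF _ _ tendsto_const, rotated 2]) (simp_all add: bound)
    then have "(\<lambda>t. norm (d t)) \<longlonglongrightarrow> 0"
      by (simp only: power_tendsto_0_iff pos2)
    then show ?thesis
      unfolding d_def by (simp add: tendsto_norm_zero_iff LIM_zero_iff)
  qed
  with \<open>\<alpha>0 > 0\<close> show ?thesis by blast
qed

lemma gradient_augmented_loss:
  fixes A :: "real^'d^'n"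
  shows "gradient (augmented_loss A b r) (x, p) =
         (transpose A *v (A *v x - b + r *\<^sub>R p), r *\<^sub>R (A *v x - b + r *\<^sub>R p))"
proof (rule gradient_eqI, unfold gderiv_def)
  let ?res = "\<lambda>z. A *v fst z - b + r *\<^sub>R snd z"
  have loss: "augmented_loss A b r = (\<lambda>z. 1 / 2 * (?res z \<bullet> ?res z))"
    by (auto simp: augmented_loss_def power2_norm_eq_inner)
  have "((\<lambda>z. A *v fst z) has_derivative (\<lambda>h. A *v fst h)) (at (x, p))"
    by (intro bounded_linear.has_derivative[OF matrix_vector_mul_bounded_linear] derivative_intros)
  then have res: "(?res has_derivative (\<lambda>h. A *v fst h + r *\<^sub>R snd h)) (at (x, p))"
    by (auto intro!: derivative_eq_intros)
  show "(augmented_loss A b r has_derivative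
      (\<lambda>h. h \<bullet> (transpose A *v (A *v x - b + r *\<^sub>R p), r *\<^sub>R (A *v x - b + r *\<^sub>R p)))) (at (x, p))"
    unfolding loss
  proof (rule has_derivative_eq_rhs[OF has_derivative_mult_right[OF has_derivative_inner[OF res res]]])
    define e where "e = A *v x - b + r *\<^sub>R p"
    have "h \<bullet> (transpose A *v e, r *\<^sub>R e) = (A *v fst h + r *\<^sub>R snd h) \<bullet> e" for h
      using transpose_mult_inner[of A e "fst h"]
      by (simp only: inner_prod_def fst_conv snd_conv inner_add_left inner_add_right inner_scaleR_left
          inner_scaleR_right inner_commute)
    then show "(\<lambda>h. 1 / 2 * (?res (x, p) \<bullet> (A *v fst h + r *\<^sub>R snd h) +
          (A *v fst h + r *\<^sub>R snd h) \<bullet> ?res (x, p))) =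
        (\<lambda>h. h \<bullet> (transpose A *v (A *v x - b + r *\<^sub>R p), r *\<^sub>R (A *v x - b + r *\<^sub>R p)))"
      unfolding e_def[symmetric] by (simp add: e_def inner_commute)
  qed
qed

text \<open>The coordinate \<open>s\<close> is \<open>p / r\<close> when \<open>r \<noteq> 0\<close>: the two components of the gradient, and hence
  of the iterates, are images of the same vector under \<open>A\<^sup>T\<close> and under scaling by \<open>r\<close>.\<close>

lemma gradient_descent_augmented_loss:
  fixes A :: "real^'d^'n"
  shows "\<exists>s. (\<forall>t. gradient_descent (augmented_loss A b r) \<alpha> (0, 0) t =
                  (transpose A *v s t, r *\<^sub>R s t)) \<and>
             (\<forall>t. s (Suc t) = s t - \<alpha> *\<^sub>R (regularised_gram (transpose A) r *v s t - b))"
proof -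
  define s where
    "s = rec_nat 0 (\<lambda>_ v. v - \<alpha> *\<^sub>R (regularised_gram (transpose A) r *v v - b))"
  have s_Suc: "s (Suc t) = s t - \<alpha> *\<^sub>R (regularised_gram (transpose A) r *v s t - b)" for t
    by (simp add: s_def)
  have "gradient_descent (augmented_loss A b r) \<alpha> (0, 0) t = (transpose A *v s t, r *\<^sub>R s t)" for t
  proof (induction t)
    case 0
    then show ?case by (simp add: s_def)
  next
    case (Suc t)
    let ?e = "regularised_gram (transpose A) r *v s t - b"
    have "A *v (transpose A *v s t) - b + r *\<^sub>R r *\<^sub>R s t = ?e"
      by (simp add: regularised_gram_mult_vector power2_eq_square del: transpose_matrix_vector)
    then have "gradient (augmented_loss A b r) (transpose A *v s t, r *\<^sub>R s t) =
        (transpose A *v ?e, r *\<^sub>R ?e)"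
      by (simp only: gradient_augmented_loss)
    then show ?case
      by (simp add: Suc.IH s_Suc matrix_vector_mult_diff_distrib matrix_vector_mult_scaleR
          scaleR_diff_right mult.commute del: transpose_matrix_vector)
  qed
  with s_Suc show ?thesis by blast
qed

lemma gradient_descent_tends_to_ridge_solution:
  fixes A :: "real^'d^'n"
  assumes "r > 0"
  shows "\<exists>\<alpha>0>0. \<forall>b \<alpha>. 0 < \<alpha> \<and> \<alpha> < \<alpha>0 \<longrightarrow>
           (\<lambda>t. fst (gradient_descent (augmented_loss A b r) \<alpha> (0, 0) t))
             \<longlonglongrightarrow> ridge_solution A b r"
proof -
  let ?M = "regularised_gram (transpose A) r"
  have "r\<^sup>2 * (norm v)\<^sup>2 \<le> v \<bullet> (?M *v v)" for v
    by (simp only: inner_regularised_gram) simp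
  then obtain \<alpha>0 where "\<alpha>0 > 0" and
    conv: "\<And>b s s' \<alpha>. 0 < \<alpha> \<Longrightarrow> \<alpha> < \<alpha>0 \<Longrightarrow> ?M *v s' = b \<Longrightarrow>
             (\<And>t. s (Suc t) = s t - \<alpha> *\<^sub>R (?M *v s t - b)) \<Longrightarrow> s \<longlonglongrightarrow> s'"
    using richardson_converges[of "r\<^sup>2" ?M] assms by (metis zero_less_power)
  have "(\<lambda>t. fst (gradient_descent (augmented_loss A b r) \<alpha> (0, 0) t)) \<longlonglongrightarrow> ridge_solution A b r"
    if \<alpha>: "0 < \<alpha>" "\<alpha> < \<alpha>0" for b \<alpha>
  proof -
    obtain s where
      iter: "\<And>t. gradient_descent (augmented_loss A b r) \<alpha> (0, 0) t =
               (transpose A *v s t, r *\<^sub>R s t)" and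
      step: "\<And>t. s (Suc t) = s t - \<alpha> *\<^sub>R (?M *v s t - b)"
      using gradient_descent_augmented_loss[of A b r \<alpha>] by blast
    define s' where "s' = matrix_inv ?M *v b"
    have s': "?M *v s' = b"
      unfolding s'_def
      using assms by (intro matrix_mult_matrix_inv_vector invertible_regularised_gram) simp
    have "s \<longlonglongrightarrow> s'"
      by (rule conv[OF \<alpha> s', of s]) (rule step)
    then have "(\<lambda>t. transpose A *v s t) \<longlonglongrightarrow> transpose A *v s'"
      by (rule bounded_linear.tendsto[OF matrix_vector_mul_bounded_linear])
    moreover have "ridge_solution A b r = transpose A *v s'"
      using assms s' by (intro ridge_solution_eq_dual) simp_all
    ultimately show ?thesis by (simp add: iter del: transpose_matrix_vector)
  qed
  with \<open>\<alpha>0 > 0\<close> show ?thesis by blast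
qed

section \<open>The limits of the ridge solution\<close>

lemma is_pinv_right_inverse:
  fixes A :: "real^'d^'n"
  assumes "(A ** transpose A) ** G = mat 1"
  shows "is_pinv A (transpose A ** G)"
proof -
  have right: "A ** (transpose A ** G) = mat 1"
    using assms by (simp add: matrix_mul_assoc)
  \<comment> \<open>\<open>G\<close> is the inverse of a symmetric matrix, hence symmetric itself.\<close>
  have "transpose ((A ** transpose A) ** G) = mat 1"
    using assms by simp
  then have "transpose G ** (A ** transpose A) = mat 1"
    by (simp add: matrix_transpose_mul)
  then have sym: "transpose G = G"
    by (metis assms matrix_mul_assoc matrix_mul_lid matrix_mul_rid)
  have "transpose (transpose A ** G ** A) = transpose A ** G ** A"
    by (simp add: matrix_transpose_mul sym matrix_mul_assoc)
  moreover have "transpose A ** G ** A ** (transpose A ** G) = transpose A ** G"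
    by (metis right matrix_mul_assoc matrix_mul_rid)
  ultimately show ?thesis
    by (simp add: is_pinv_def right)
qed

lemma pinv_eqI:
  assumes "is_pinv A X"
  shows "pinv A = X"
  unfolding pinv_def using assms is_pinv_unique by blast

text \<open>For full row rank \<open>A\<^sup>T\<close> is injective, hence so is \<open>A A\<^sup>T\<close>.\<close>

lemma pinv_full_row_rank:
  fixes A :: "real^'d^'n"
  assumes "rank A = CARD('n)"
  obtains G where "pinv A = transpose A ** G" "A ** pinv A = mat 1"
proof -
  have inj: "inj ((*v) (transpose A))"
    using assms by (simp add: full_rank_injective[symmetric] rank_transpose
        del: transpose_matrix_vector)
  have "x = 0" if "(A ** transpose A) *v x = 0" for x
  proof -
    have "(transpose A *v x) \<bullet> (transpose A *v x) = x \<bullet> (A *v (transpose A *v x))"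
      by (rule transpose_mult_inner)
    also have "\<dots> = 0"
      using that by (simp add: matrix_vector_mul_assoc del: transpose_matrix_vector)
    finally have "transpose A *v x = transpose A *v 0" by simp
    then show "x = 0" by (rule injD[OF inj])
  qed
  then have "invertible (A ** transpose A)"
    by (simp add: invertible_left_inverse matrix_left_invertible_ker)
  then obtain G where G: "(A ** transpose A) ** G = mat 1"
    by (auto simp: invertible_def)
  have "pinv A = transpose A ** G"
    by (intro pinv_eqI is_pinv_right_inverse G)
  with G that show ?thesis by (simp add: matrix_mul_assoc)
qed

text \<open>With \<open>x\<^sub>0 = A\<^sup>T s\<close> and \<open>d\<close> the difference vector, \<open>(A\<^sup>T A + r\<^sup>2 I) d = - r\<^sup>2 A\<^sup>T s\<close>.  Testing with
  \<open>d\<close> gives \<open>\<parallel>A d\<parallel>\<^sup>2 + r\<^sup>2 \<parallel>d\<parallel>\<^sup>2 = - r\<^sup>2 \<langle>s, A d\<rangle>\<close>, and the term \<open>\<parallel>A d\<parallel>\<^sup>2\<close> absorbs the right-hand side up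
  to a remainder of order \<open>r\<^sup>4\<close>.\<close>

lemma ridge_solution_distance:
  assumes "r > 0" "A *v (transpose A *v s) = b"
  shows "norm (ridge_solution A b r - transpose A *v s) \<le> r * norm s"
proof -
  define d where "d = ridge_solution A b r - transpose A *v s"
  have "regularised_gram A r *v d = - (r\<^sup>2 *\<^sub>R (transpose A *v s))"
    using assms ridge_solution_normal_equation[of r A b] unfolding d_def matrix_vector_mult_diff_distrib
    by (simp add: regularised_gram_mult_vector[of A r "transpose A *v s"]
        del: transpose_matrix_vector)
  then have "(norm (A *v d))\<^sup>2 + r\<^sup>2 * (norm d)\<^sup>2 = - (r\<^sup>2 * (s \<bullet> (A *v d)))"
    unfolding inner_regularised_gram[symmetric]
    by (simp add: inner_commute[of d] transpose_mult_inner del: transpose_matrix_vector)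
  moreover have "0 \<le> (norm (A *v d + r\<^sup>2 *\<^sub>R s))\<^sup>2" "0 \<le> (norm (A *v d))\<^sup>2"
    by simp_all
  moreover have "(norm (A *v d + r\<^sup>2 *\<^sub>R s))\<^sup>2 =
      (norm (A *v d))\<^sup>2 + 2 * (r\<^sup>2 * (s \<bullet> (A *v d))) + r\<^sup>2 * (r * norm s)\<^sup>2"
    unfolding power2_norm_eq_inner power_mult_distrib
    by (simp add: inner_simps inner_commute power2_eq_square algebra_simps)
  ultimately have "r\<^sup>2 * (norm d)\<^sup>2 \<le> r\<^sup>2 * (r * norm s)\<^sup>2"
    by (smt (verit) mult_nonneg_nonneg zero_le_power2)
  then have "(norm d)\<^sup>2 \<le> (r * norm s)\<^sup>2"
    using assms(1) by simp
  then show ?thesis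
    unfolding d_def[symmetric] by (rule power2_le_imp_le) (use assms(1) in simp)
qed

lemma ridge_solution_tendsto_pinv:
  fixes A :: "real^'d^'n"
  assumes "rank A = CARD('n)"
  shows "(ridge_solution A b \<longlongrightarrow> pinv A *v b) (at_right 0)"
proof -
  obtain G where G: "pinv A = transpose A ** G" "A ** pinv A = mat 1"
    using pinv_full_row_rank[OF assms] .
  define s where "s = G *v b"
  have x0: "pinv A *v b = transpose A *v s"
    by (simp add: G(1) s_def matrix_vector_mul_assoc del: transpose_matrix_vector)
  have "A *v (transpose A *v s) = b"
    by (simp only: x0[symmetric] matrix_vector_mul_assoc G(2) matrix_vector_mul_lid)
  then have "\<forall>\<^sub>F r in at_right 0. norm (ridge_solution A b r - pinv A *v b) \<le> r * norm s"
    unfolding x0 by (auto intro!: eventually_at_right_less[THEN eventually_mono]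
        ridge_solution_distance simp del: transpose_matrix_vector)
  moreover have "((\<lambda>r. r * norm s) \<longlongrightarrow> 0) (at_right 0)"
    by (intro tendsto_mult_left_zero tendsto_ident_at)
  ultimately have "((\<lambda>r. ridge_solution A b r - pinv A *v b) \<longlongrightarrow> 0) (at_right 0)"
    by (rule Lim_null_comparison)
  then show ?thesis by (rule Lim_null[THEN iffD2])
qed

lemma ridge_solution_norm_le:
  assumes "r > 0"
  shows "norm (ridge_solution A b r) \<le> norm (transpose A *v b) / r\<^sup>2"
proof -
  define x where "x = ridge_solution A b r"
  have "r\<^sup>2 * (norm x)\<^sup>2 \<le> x \<bullet> (regularised_gram A r *v x)"
    by (simp only: inner_regularised_gram) simp
  also have "\<dots> = x \<bullet> (transpose A *v b)"
    using assms by (simp add: x_def ridge_solution_normal_equation del: transpose_matrix_vector)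
  also have "\<dots> \<le> norm x * norm (transpose A *v b)"
    by (rule norm_cauchy_schwarz)
  finally have "norm x * (r\<^sup>2 * norm x) \<le> norm x * norm (transpose A *v b)"
    by (simp add: power2_eq_square mult_ac)
  then have "r\<^sup>2 * norm x \<le> norm (transpose A *v b)"
    by (cases "x = 0") (auto simp del: transpose_matrix_vector)
  then show ?thesis
    using assms by (simp add: x_def field_simps del: transpose_matrix_vector)
qed

lemma ridge_solution_tendsto_0: "(ridge_solution A b \<longlongrightarrow> 0) at_top"
proof (rule Lim_null_comparison)
  show "\<forall>\<^sub>F r in at_top. norm (ridge_solution A b r) \<le> norm (transpose A *v b) / r\<^sup>2"
    using eventually_gt_at_top[of 0] by eventually_elim (rule ridge_solution_norm_le)
  show "((\<lambda>r. norm (transpose A *v b) / r\<^sup>2) \<longlongrightarrow> 0) at_top"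
    by (intro tendsto_divide_0[OF tendsto_const] filterlim_at_top_imp_at_infinity
        filterlim_pow_at_top filterlim_ident) simp
qed

lemma tendsto_least_squares:
  assumes "(x \<longlongrightarrow> x0) F"
  shows "((\<lambda>r. least_squares A b (x r)) \<longlongrightarrow> least_squares A b x0) F"
  unfolding least_squares_def
  by (intro tendsto_intros bounded_linear.tendsto[OF matrix_vector_mul_bounded_linear] assms)

section \<open>Implicit ridge regularisation by gradient descent\<close>

theorem theorem1:
  fixes A :: "real^'d^'n"
  assumes "rank A = CARD('n)"
  shows "(\<forall>r>0. \<exists>\<alpha>0>0. \<forall>(b :: real^'n) \<alpha>. 0 < \<alpha> \<and> \<alpha> < \<alpha>0 \<longrightarrow>
            (\<lambda>t. fst (gradient_descent (augmented_loss A b r) \<alpha> (0, 0) t))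
              \<longlonglongrightarrow> ridge_solution A b r)
       \<and> (\<forall>(b :: real^'n) r. r > 0 \<longrightarrow>
            (\<exists>!x. is_arg_min (ridge_objective A b r) (\<lambda>_. True) x)
            \<and> invertible (transpose A ** A + r\<^sup>2 *\<^sub>R mat 1)
            \<and> ridge_solution A b r =
                matrix_inv (transpose A ** A + r\<^sup>2 *\<^sub>R mat 1) *v (transpose A *v b))
       \<and> (\<forall>b :: real^'n.
            (ridge_solution A b \<longlongrightarrow> pinv A *v b) (at_right 0)
            \<and> (ridge_solution A b \<longlongrightarrow> 0) at_top
            \<and> ((\<lambda>r. least_squares A b (ridge_solution A b r)) \<longlongrightarrow> 0) (at_right 0)
            \<and> ((\<lambda>r. least_squares A b (ridge_solution A b r))
                 \<longlongrightarrow> 1 / 2 * (norm b)\<^sup>2) at_top)"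
proof (intro conjI allI impI)
  fix r :: real
  assume "r > 0"
  then show "\<exists>\<alpha>0>0. \<forall>(b :: real^'n) \<alpha>. 0 < \<alpha> \<and> \<alpha> < \<alpha>0 \<longrightarrow>
      (\<lambda>t. fst (gradient_descent (augmented_loss A b r) \<alpha> (0, 0) t)) \<longlonglongrightarrow> ridge_solution A b r"
    by (rule gradient_descent_tends_to_ridge_solution)
next
  fix b :: "real^'n" and r :: real
  assume "r > 0"
  then have "r \<noteq> 0" by simp
  show "\<exists>!x. is_arg_min (ridge_objective A b r) (\<lambda>_. True) x"
    by (simp add: is_arg_min_ridge_objective_iff[OF \<open>r \<noteq> 0\<close>
          ridge_solution_normal_equation[OF \<open>r \<noteq> 0\<close>]])
  show "invertible (transpose A ** A + r\<^sup>2 *\<^sub>R mat 1)"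
    using invertible_regularised_gram[OF \<open>r \<noteq> 0\<close>, of A] unfolding regularised_gram_def .
  show "ridge_solution A b r =
      matrix_inv (transpose A ** A + r\<^sup>2 *\<^sub>R mat 1) *v (transpose A *v b)"
    using ridge_solution_eq_matrix_inv[OF \<open>r \<noteq> 0\<close>, of A b] unfolding regularised_gram_def .
next
  fix b :: "real^'n"
  show to_pinv: "(ridge_solution A b \<longlongrightarrow> pinv A *v b) (at_right 0)"
    by (rule ridge_solution_tendsto_pinv[OF assms])
  show to_0: "(ridge_solution A b \<longlongrightarrow> 0) at_top"
    by (rule ridge_solution_tendsto_0)
  have "A ** pinv A = mat 1"
    using pinv_full_row_rank[OF assms] .
  then have "least_squares A b (pinv A *v b) = 0"
    by (simp add: least_squares_def matrix_vector_mul_assoc)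
  then show "((\<lambda>r. least_squares A b (ridge_solution A b r)) \<longlongrightarrow> 0) (at_right 0)"
    using tendsto_least_squares[OF to_pinv, of A b] by simp
  show "((\<lambda>r. least_squares A b (ridge_solution A b r)) \<longlongrightarrow> 1 / 2 * (norm b)\<^sup>2) at_top"
    using tendsto_least_squares[OF to_0, of A b] by (simp add: least_squares_def)
qed

end
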